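(* Let $A$ be an algebra over an infinite field. Then, given nilpotent elements $x,y\in A$, the commutator $[x,y]=xy-yx$ is a finite sum of nilpotent elements of $A$.
   Context: Algebras are associative and not necessarily unital. *)

theory Defs imports Complex_Main begin

text \<open>The type class \<open>ring\<close> is that of associative rings without a unit axiom.\<close>

locale algebra_over_field = vector_space scale
  for scale :: "'k::field \<Rightarrow> 'a::ring \<Rightarrow> 'a" (infixr \<open>*s\<close> 75) +
  assumes scale_mult_left: "(c *s x) * y = c *s (x * y)"
    and mult_scale_right: "x * (c *s y) = c *s (x * y)"

text \<open>Without a unit only the positive powers of \<open>x\<close> exist, and
  \<open>pos_power x n\<close> is the power of \<open>x\<close> with exponent \<open>n + 1\<close>.\<close>

primrec pos_power :: "'a::semigroup_mult \<Rightarrow> nat \<Rightarrow> 'a" where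
  "pos_power x 0 = x"
| "pos_power x (Suc n) = pos_power x n * x"

definition nilpotent :: "'a::ring \<Rightarrow> bool" where
  "nilpotent x \<longleftrightarrow> (\<exists>n. pos_power x n = 0)"

definition commutator :: "'a::ring \<Rightarrow> 'a \<Rightarrow> 'a" where
  "commutator x y = x * y - y * x"

end

theory Submission imports Defs "HOL-Computational_Algebra.Polynomial" begin

text \<open>In the unital hull of \<open>A\<close> the conjugates \<open>(1 - t x) y (1 - t x)\<^sup>-\<^sup>1\<close>
  are nilpotent for every scalar \<open>t\<close>. They depend polynomially on \<open>t\<close>, with linear
  coefficient \<open>y x - x y\<close>. Over an infinite field the coefficients of a polynomial lie in
  any subspace that contains all its values, here the span of the nilpotent elements.\<close>

text \<open>Each polynomial \<open>X ^ k - X ^ n\<close> with \<open>k < n\<close> is nonzero, so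
  all of them together have only finitely many roots.\<close>

lemma infinite_field_ex_separating_powers:
  assumes "infinite (UNIV :: 'k::field set)"
  shows "\<exists>s::'k. \<forall>k<n. s ^ k \<noteq> s ^ n"
proof -
  have "finite {s::'k. s ^ k = s ^ n}" if "k < n" for k
  proof -
    have "monom 1 k \<noteq> (monom 1 n :: 'k poly)"
      using that by (simp add: monom_eq_iff')
    then have "monom 1 k - monom 1 n \<noteq> (0 :: 'k poly)"
      by simp
    from poly_roots_finite[OF this] show ?thesis
      by (simp add: poly_monom)
  qed
  then have "finite (\<Union>k<n. {s::'k. s ^ k = s ^ n})"
    by blast
  then obtain s :: 'k where "s \<notin> (\<Union>k<n. {s. s ^ k = s ^ n})"
    using assms ex_new_if_finite by blast
  then show ?thesis by auto
qed

lemma (in vector_space) coefficient_in_subspace: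
  assumes "infinite (UNIV :: 'a set)" and "subspace S"
    and "\<And>t. (\<Sum>k<n. scale (t ^ k) (c k)) \<in> S" and "k < n"
  shows "c k \<in> S"
  using assms(3,4)
proof (induction n arbitrary: c k)
  case 0
  then show ?case by simp
next
  case (Suc n)
  obtain s :: 'a where s: "\<And>k. k < n \<Longrightarrow> s ^ k \<noteq> s ^ n"
    using infinite_field_ex_separating_powers[OF assms(1)] by blast
  define d where "d k = scale (s ^ k - s ^ n) (c k)" for k
  \<comment> \<open>With \<open>p\<close> for the given polynomial, \<open>p (s t) - s ^ n p t\<close> has no term of degree \<open>n\<close>.\<close>
  have "(\<Sum>k<n. scale (t ^ k) (d k)) =
      (\<Sum>k<Suc n. scale ((s * t) ^ k) (c k)) - scale (s ^ n) (\<Sum>k<Suc n. scale (t ^ k) (c k))" for t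
  proof -
    have "scale (t ^ k) (d k) = scale ((s * t) ^ k) (c k) - scale (s ^ n) (scale (t ^ k) (c k))" for k
      by (simp add: d_def scale_left_diff_distrib scale_right_diff_distrib power_mult_distrib mult.commute)
    then show ?thesis
      by (simp add: scale_sum_right scale_right_distrib sum_subtractf power_mult_distrib)
  qed
  then have "(\<Sum>k<n. scale (t ^ k) (d k)) \<in> S" for t
    using Suc.prems(1) assms(2) by (simp add: subspace_diff subspace_scale del: sum.lessThan_Suc)
  then have "d k \<in> S" if "k < n" for k
    using Suc.IH that by blast
  \<comment> \<open>The factor \<open>s ^ k - s ^ n\<close> is nonzero by the choice of
    \<open>s\<close>, so it can be divided out.\<close>
  then have less: "c k \<in> S" if "k < n" for k
    using that s[OF that] subspace_scale[OF assms(2), of "d k" "inverse (s ^ k - s ^ n)"]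
    by (simp add: d_def)
  \<comment> \<open>The value at \<open>t = 1\<close> is the sum of all coefficients; removing the
    lower ones leaves the top one.\<close>
  have "(\<Sum>k<Suc n. scale (1 ^ k) (c k)) - (\<Sum>k<n. c k) \<in> S"
    by (intro subspace_diff[OF assms(2)] subspace_sum[OF assms(2)] Suc.prems(1) less) auto
  then have "c n \<in> S" by simp
  with less Suc.prems(2) show ?case
    by (auto simp: less_Suc_eq)
qed

text \<open>The map \<open>u \<mapsto> (1 + b) u (1 + a)\<close>, expanded so as not to use a unit. The
  hypothesis on \<open>a\<close> and \<open>b\<close> below says \<open>(1 + a) (1 + b) = 1\<close>.\<close>

definition quasi_conj :: "'a::ring \<Rightarrow> 'a \<Rightarrow> 'a \<Rightarrow> 'a" where
  "quasi_conj b a u = u + b * u + u * a + b * u * a"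

text \<open>In the product the inner factors \<open>(1 + a) (1 + b)\<close> cancel.\<close>

lemma quasi_conj_mult:
  assumes "a + b + a * b = 0"
  shows "quasi_conj b a u * quasi_conj b a v = quasi_conj b a (u * v)"
proof -
  have ab: "a * b = - a - b"
    using assms by (simp add: algebra_simps eq_neg_iff_add_eq_0)
  \<comment> \<open>Once products are associated to the right, \<open>a * b\<close> occurs only in
    this form.\<close>
  have reduce: "a * (b * w) = - (a * w) - b * w" for w
    by (simp add: mult.assoc[symmetric] ab left_diff_distrib)
  show ?thesis
    unfolding quasi_conj_def distrib_left distrib_right mult.assoc reduce right_diff_distrib
    by (simp add: algebra_simps)
qed

lemma nilpotent_quasi_conj:
  assumes "a + b + a * b = 0" and "nilpotent u"
  shows "nilpotent (quasi_conj b a u)"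
proof -
  have "pos_power (quasi_conj b a u) n = quasi_conj b a (pos_power u n)" for n
    by (induction n) (simp_all add: quasi_conj_mult[OF assms(1)])
  moreover have "quasi_conj b a 0 = 0"
    by (simp add: quasi_conj_def)
  ultimately show ?thesis
    using assms(2) unfolding nilpotent_def by metis
qed

context algebra_over_field
begin

lemma nilpotent_scale:
  assumes "nilpotent x"
  shows "nilpotent (c *s x)"
proof -
  have "pos_power (c *s x) n = c ^ Suc n *s pos_power x n" for n
    by (induction n) (simp_all add: scale_mult_left mult_scale_right mult_ac)
  then show ?thesis
    using assms unfolding nilpotent_def by (metis scale_zero_right)
qed

text \<open>Scalar multiples of nilpotent elements are nilpotent, so the scalars of a linear
  combination are absorbed into its terms.\<close>

lemma span_nilpotent_sum_list:
  assumes "z \<in> span {x. nilpotent x}"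
  shows "\<exists>zs. (\<forall>z \<in> set zs. nilpotent z) \<and> z = sum_list zs"
  using assms
proof (induction rule: span_induct_alt)
  case base
  show ?case by (rule exI[of _ "[]"]) simp
next
  case (step c x z)
  then obtain zs where "\<forall>z \<in> set zs. nilpotent z" "z = sum_list zs"
    by blast
  with step show ?case
    by (intro exI[of _ "(c *s x) # zs"]) (simp add: nilpotent_scale)
qed

lemma commutator_in_span_nilpotent:
  assumes inf: "infinite (UNIV :: 'k set)" and "nilpotent x" and y: "nilpotent y"
  shows "commutator x y \<in> span {z. nilpotent z}"
proof -
  obtain n where n: "pos_power x n = 0"
    using assms(2) by (auto simp: nilpotent_def)
  \<comment> \<open>These are the coefficients \<open>y x^k - x y x^(k-1)\<close> of the conjugate;
    the first two are separate because there is no \<open>x^0\<close>.\<close>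
  define c where "c k = (case k of 0 \<Rightarrow> y | Suc 0 \<Rightarrow> y * x - x * y
    | Suc (Suc j) \<Rightarrow> y * pos_power x (Suc j) - x * y * pos_power x j)" for k
  have "(\<Sum>k<Suc (Suc n). t ^ k *s c k) \<in> span {z. nilpotent z}" for t
  proof -
    \<comment> \<open>Here \<open>1 + b\<close> is \<open>1 - t x\<close>, and \<open>1 + a\<close>
      is its inverse, the geometric series, which stops after \<open>x^n\<close> since
      \<open>x^(n+1) = 0\<close>.\<close>
    define b where "b = - (t *s x)"
    define a where "a = (\<Sum>k<n. t ^ Suc k *s pos_power x k)"
    \<comment> \<open>Adding the vanishing term lets the tail after \<open>t *s x\<close> match
      \<open>- (a * b)\<close> term by term.\<close>
    have "a = (\<Sum>k<Suc n. t ^ Suc k *s pos_power x k)"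
      by (simp add: a_def n)
    also have "\<dots> = t *s x + (\<Sum>k<n. t ^ Suc (Suc k) *s pos_power x (Suc k))"
      by (subst sum.lessThan_Suc_shift) simp
    finally have a: "a = t *s x + (\<Sum>k<n. t ^ Suc (Suc k) *s pos_power x (Suc k))" .
    have "a * b = - (\<Sum>k<n. t ^ Suc (Suc k) *s pos_power x (Suc k))"
      by (simp add: a_def b_def sum_distrib_right scale_sum_right scale_mult_left mult_scale_right
          mult_ac)
    then have "a + b + a * b = 0"
      by (simp add: a b_def)
    then have "nilpotent (quasi_conj b a y)"
      using y by (rule nilpotent_quasi_conj)
    moreover have "quasi_conj b a y = (\<Sum>k<Suc (Suc n). t ^ k *s c k)"
    proof -
      have "y * a = t *s (y * x) + (\<Sum>k<n. t ^ Suc (Suc k) *s (y * pos_power x (Suc k)))"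
        by (simp add: a distrib_left sum_distrib_left mult_scale_right)
      moreover have "b * y * a = - (\<Sum>k<n. t ^ Suc (Suc k) *s (x * y * pos_power x k))"
        by (simp add: a_def b_def sum_distrib_left sum_negf scale_sum_right scale_mult_left mult_scale_right
            mult_ac)
      moreover have "b * y = - (t *s (x * y))"
        by (simp add: b_def scale_mult_left)
      ultimately have "quasi_conj b a y = y + t *s (y * x - x * y) +
          (\<Sum>k<n. t ^ Suc (Suc k) *s (y * pos_power x (Suc k) - x * y * pos_power x k))"
        by (simp add: quasi_conj_def scale_right_diff_distrib sum_subtractf
            del: power_Suc pos_power.simps)
      also have "\<dots> = (\<Sum>k<Suc (Suc n). t ^ k *s c k)"
        by (simp add: sum.lessThan_Suc_shift c_def add.assoc del: sum.lessThan_Suc)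
      finally show ?thesis .
    qed
    ultimately show ?thesis
      by (metis mem_Collect_eq span_base)
  qed
  \<comment> \<open>Index 1 is in range for every \<open>n\<close>, and its coefficient is the
    negative of the commutator.\<close>
  from coefficient_in_subspace[OF inf subspace_span this, of 1]
  have "- (y * x - x * y) \<in> span {z. nilpotent z}"
    by (intro subspace_neg) (simp_all add: c_def)
  then show ?thesis
    by (simp add: commutator_def)
qed

end

theorem proposition5p4:
  fixes scale :: "'k::field \<Rightarrow> 'a::ring \<Rightarrow> 'a" and x y :: 'a
  assumes "algebra_over_field scale"
    and "infinite (UNIV :: 'k set)"
    and "nilpotent x" and "nilpotent y"
  shows "\<exists>zs :: 'a list. (\<forall>z \<in> set zs. nilpotent z) \<and> commutator x y = sum_list zs"
proof -
  interpret algebra_over_field scale by fact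
  show ?thesis
    using assms(2-4) by (intro span_nilpotent_sum_list commutator_in_span_nilpotent)
qed

end
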